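(* Let $\mathbb K$ be a field with $\operatorname{char}\mathbb K\ne2$. For every polynomial $D\in\mathcal S_{\mathbb K}$ with $\deg D=2d$ there exist infinitely many pairwise non-equivalent elements $\alpha$ of $\mathbb K(T,\sqrt D)$ such that $K(\alpha)\le d$.
   Context: $\mathbb L=\mathbb K((T^{-1}))$. $\mathcal S_{\mathbb K}$ is the set of polynomials of positive even degree in $\mathbb K[T]$, not squares, with leading coefficient a square in $\mathbb K$; $\sqrt D\in\mathbb L$ is a square root of $D$. For $\alpha\in\mathbb L$ with regular continued fraction $[a_0,a_1,\dots]$ ($\alpha_0=\alpha$, $a_j=\lfloor\alpha_j\rfloor$ the polynomial part, $\alpha_{j+1}=1/(\alpha_j-a_j)$), $K(\alpha)=\sup_{j\ge1}\deg a_j$. $\alpha,\beta$ are equivalent if $\beta=\frac{A\alpha+B}{C\alpha+E}$ with $\begin{pmatrix}A&B\\C&E\end{pmatrix}\in\mathrm{GL}_2(\mathbb K[T])$. *)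

theory Defs
  imports
    "HOL-Analysis.Analysis"
    "HOL-Computational_Algebra.Computational_Algebra"
    "HOL-Library.Extended_Nat"
begin

(* The field K((1/T)) is the library type 'a fls, whose formal variable fls_X is read as 1/T;
   thus T is fls_X_inv, and the coefficient of T^n sits at index -n. *)

definition poly_to_L :: "'a::field poly \<Rightarrow> 'a fls" where
  "poly_to_L p = poly (map_poly fls_const p) fls_X_inv"

(* fls_prpart collects the strictly negative indices only, so the constant term is added. *)
definition poly_part :: "'a::field fls \<Rightarrow> 'a poly" where
  "poly_part f = fls_prpart f + [:fls_nth f 0:]"

definition in_S :: "'a::field poly \<Rightarrow> bool" where
  "in_S D \<longleftrightarrow> degree D > 0 \<and> even (degree D) \<and> (\<nexists>p. D = p ^ 2) \<and> (\<exists>c. lead_coeff D = c ^ 2)"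

definition is_subfield :: "'b::field set \<Rightarrow> bool" where
  "is_subfield F \<longleftrightarrow> 0 \<in> F \<and> 1 \<in> F
     \<and> (\<forall>x\<in>F. \<forall>y\<in>F. x - y \<in> F \<and> x * y \<in> F) \<and> (\<forall>x\<in>F. inverse x \<in> F)"

(* K(T, s), as a subfield of K((1/T)) *)
definition adjoin_T :: "'a::field fls \<Rightarrow> 'a fls set" where
  "adjoin_T s = \<Inter>{F. is_subfield F \<and> range fls_const \<subseteq> F \<and> fls_X_inv \<in> F \<and> s \<in> F}"

(* The n-th complete quotient; None once the expansion has terminated. *)
primrec complete_quotient :: "'a::field fls \<Rightarrow> nat \<Rightarrow> 'a fls option" where
  "complete_quotient \<alpha> 0 = Some \<alpha>"
| "complete_quotient \<alpha> (Suc n) =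
     (case complete_quotient \<alpha> n of
        None \<Rightarrow> None
      | Some \<beta> \<Rightarrow> if \<beta> = poly_to_L (poly_part \<beta>) then None
                   else Some (1 / (\<beta> - poly_to_L (poly_part \<beta>))))"

definition partial_quotient :: "'a::field fls \<Rightarrow> nat \<Rightarrow> 'a poly option" where
  "partial_quotient \<alpha> n = map_option poly_part (complete_quotient \<alpha> n)"

definition K_sup :: "'a::field fls \<Rightarrow> enat" where
  "K_sup \<alpha> = Sup {enat (degree a) | a j. j \<ge> 1 \<and> partial_quotient \<alpha> j = Some a}"

(* The nonvanishing denominator says that the image of \<alpha> is not the point at infinity. *)
definition cf_equivalent :: "'a::field fls \<Rightarrow> 'a fls \<Rightarrow> bool" where
  "cf_equivalent \<alpha> \<beta> \<longleftrightarrow> (\<exists>M :: 'a poly ^ 2 ^ 2. invertible M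
     \<and> poly_to_L (M $ 2 $ 1) * \<alpha> + poly_to_L (M $ 2 $ 2) \<noteq> 0
     \<and> \<beta> = (poly_to_L (M $ 1 $ 1) * \<alpha> + poly_to_L (M $ 1 $ 2))
            / (poly_to_L (M $ 2 $ 1) * \<alpha> + poly_to_L (M $ 2 $ 2)))"

lemma poly_to_L_pCons: "poly_to_L (pCons a p) = fls_const a + fls_X_inv * poly_to_L p"
  by (cases "a = 0 \<and> p = 0") (auto simp: poly_to_L_def map_poly_pCons)

lemma poly_to_L_nth: "fls_nth (poly_to_L p) k = (if k \<le> 0 then coeff p (nat (- k)) else 0)"
proof (induction p arbitrary: k)
  case 0
  then show ?case by (simp add: poly_to_L_def)
next
  case (pCons a p)
  show ?case
    using pCons.IH[of "k + 1"]
    by (auto simp: poly_to_L_pCons fls_X_inv_times_conv_shift coeff_pCons nat_diff_distrib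
             split: nat.splits intro!: arg_cong[where f = "coeff p"])
qed

lemma poly_part_nth: "coeff (poly_part f) n = fls_nth f (- int n)"
  by (auto simp: poly_part_def coeff_pCons split: nat.splits)

lemma poly_part_poly_to_L: "poly_part (poly_to_L p) = p"
  by (intro poly_eqI) (simp add: poly_part_nth poly_to_L_nth)

fun sqrt_coeff :: "(nat \<Rightarrow> 'a::field) \<Rightarrow> 'a \<Rightarrow> nat \<Rightarrow> 'a" where
  "sqrt_coeff a c 0 = c"
| "sqrt_coeff a c (Suc n) =
     (a (Suc n) - (\<Sum>i\<in>{1..n}. if i \<in> {1..n} then sqrt_coeff a c i * sqrt_coeff a c (Suc n - i) else 0))
       / (2 * c)"

(* The standing remark that D in S_K has a square root in K((1/T)). *)
lemma in_S_sqrt_exists: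
  fixes D :: "'a::field poly"
  assumes "CHAR('a) \<noteq> 2" and "in_S D"
  shows "\<exists>s. s ^ 2 = poly_to_L D"
proof -
  have two: "(2::'a) \<noteq> 0"
  proof
    assume "(2::'a) = 0"
    then have "of_nat 2 = (0::'a)" by simp
    then have "CHAR('a) dvd 2" by (simp only: of_nat_eq_0_iff_char_dvd)
    then have "CHAR('a) = 1 \<or> CHAR('a) = 2"
      using two_is_prime_nat prime_nat_iff by blast
    then show False using assms(1) CHAR_not_1 by auto
  qed
  obtain d where d: "degree D = 2 * d" using assms(2) by (auto simp: in_S_def)
  obtain c where c: "lead_coeff D = c ^ 2" using assms(2) by (auto simp: in_S_def)
  have "D \<noteq> 0" using assms(2) by (auto simp: in_S_def)
  then have c0: "c \<noteq> 0" using c by auto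
  define a where "a = coeff (reflect_poly D)"
  define r where "r = Abs_fps (sqrt_coeff a c)"
  have r2: "r * r = fps_of_poly (reflect_poly D)"
  proof (rule fps_ext)
    fix n
    show "fps_nth (r * r) n = fps_nth (fps_of_poly (reflect_poly D)) n"
    proof (cases n)
      case 0
      then show ?thesis using c by (simp add: r_def fps_mult_nth power2_eq_square)
    next
      case (Suc m)
      let ?f = "\<lambda>i. sqrt_coeff a c i * sqrt_coeff a c (Suc m - i)"
      have "fps_nth (r * r) n = (\<Sum>i=0..Suc m. ?f i)"
        by (simp add: Suc r_def fps_mult_nth)
      also have "{0..Suc m} = insert 0 (insert (Suc m) {1..m})" by auto
      also have "(\<Sum>i\<in>\<dots>. ?f i) = 2 * c * sqrt_coeff a c (Suc m) + (\<Sum>i\<in>{1..m}. ?f i)"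
        by (simp del: sqrt_coeff.simps(2))
      also have "2 * c * sqrt_coeff a c (Suc m) = a (Suc m) - (\<Sum>i\<in>{1..m}. ?f i)"
        using two c0 by simp
      finally show ?thesis by (simp add: Suc a_def)
    qed
  qed
  have shift: "poly_to_L D = fls_shift (int (2 * d)) (fps_to_fls (fps_of_poly (reflect_poly D)))"
    by (rule fls_eqI)
       (auto simp: poly_to_L_nth coeff_reflect_poly d nat_diff_distrib coeff_eq_0
             intro!: arg_cong[where f = "coeff D"])
  have "(fls_shift (int d) (fps_to_fls r)) ^ 2 = poly_to_L D"
    unfolding shift
    by (simp add: power2_eq_square fls_shifted_times_simps flip: r2 fls_times_fps_to_fls)
  then show ?thesis by blast
qed

end

(* For conjugate quadratic elements \<alpha>, \<alpha>' the degree of a partial quotient is the degree of \<alpha> - \<alpha>'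
   minus the degree of a value of (x - \<alpha> y)(x - \<alpha>' y), so it suffices that this form takes no values of
   degree below deg (\<alpha> - \<alpha>') - d.  Write s for the square root of D.

   If p^2 - D q^2 is never constant for q \<noteq> 0, then s / (T - l) has this property for every l, because
   a constant value would solve the Pell equation; K is then infinite by Dirichlet's pigeonhole argument,
   so there are enough l.

   If p^2 - D q^2 = nu is constant with q \<noteq> 0, then q (1 + s) / p has this property.  Up to the factor
   p^2 its form is u^2 + 2 p u y + nu y^2 with u = p (x - y) - q y.  Vieta jumping reduces to
   deg y < deg p, where q / p is too badly approximable for u to be small.  Cubing p + q s repeatedly
   gives infinitely many pairs, and equivalence of two of the resulting elements forces q2 to
   divide p1 q1, which is impossible by degree. *)
theory Submission
  imports Defs
begin

section \<open>Polynomial Pell equations\<close>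

definition nonsquare :: "'a::field poly \<Rightarrow> bool" where
  "nonsquare D \<longleftrightarrow> (\<nexists>r. D = r\<^sup>2)"

text \<open>Descent on the degree of the denominator: if \<open>x / y\<close> is a square root of
  \<open>D\<close>, so is \<open>(D * y - Q * x) / (x - Q * y)\<close> for every \<open>Q\<close>,
  and the quotient of \<open>x\<close> by \<open>y\<close> makes the new denominator the
  remainder.\<close>

lemma nonsquare_irrational:
  fixes D x y :: "'a::field poly"
  assumes "nonsquare D" and "x\<^sup>2 = D * y\<^sup>2"
  shows "y = 0"
  using assms(2)
proof (induction "degree y" arbitrary: x y rule: less_induct)
  case less
  show ?case
  proof (rule ccontr)
    assume y: "y \<noteq> 0"
    \<comment> \<open>\<open>x/y\<close> and \<open>t/r\<close> are the same square root of \<open>D\<close>.\<close>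
    define Q where "Q = x div y"
    define r where "r = x mod y"
    define t where "t = y * D - Q * x"
    have x: "x = Q * y + r" unfolding Q_def r_def by simp
    have "t\<^sup>2 - D * r\<^sup>2 = (D - Q\<^sup>2) * (D * y\<^sup>2 - x\<^sup>2)"
      unfolding t_def x by algebra
    then have t: "t\<^sup>2 = D * r\<^sup>2" using less.prems by simp
    have r: "r \<noteq> 0"
    proof
      assume "r = 0"
      then have "(Q\<^sup>2 - D) * y\<^sup>2 = 0" using less.prems x by algebra
      then have "D = Q\<^sup>2" using y by simp
      then show False using assms(1) by (auto simp: nonsquare_def)
    qed
    then have "degree r < degree y" unfolding r_def using y degree_mod_less by blast
    then show False using less.hyps t r by blast
  qed
qed

text \<open>The right-hand side is any nonzero constant, that is any unit of K[T], and not just 1: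
  the case distinction supplies only a constant, and cubing a solution turns \<open>nu\<close> into
  \<open>nu ^ 3\<close>.\<close>

locale pell_solution =
  fixes D p q :: "'a::field poly" and nu :: 'a and d :: nat
  assumes nonsq: "nonsquare D"
    and deg_D: "degree D = 2 * d" and d_pos: "d > 0"
    and pell: "p\<^sup>2 = D * q\<^sup>2 + [:nu:]" and nu: "nu \<noteq> 0" and q_nz: "q \<noteq> 0"
    and two: "(2::'a) \<noteq> 0"
begin

lemma D_nz: "D \<noteq> 0" using deg_D d_pos by auto

lemma two_poly: "(2::'a poly) \<noteq> 0"
proof
  assume "(2::'a poly) = 0"
  then have "coeff (2::'a poly) 0 = 0" by simp
  then show False using two by (simp add: numeral_poly)
qed

lemma degree_p: "degree p = degree q + d"
proof -
  have "degree (p\<^sup>2) = degree (D * q\<^sup>2)"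
    unfolding pell using d_pos D_nz q_nz
    by (intro degree_add_eq_left) (simp add: degree_mult_eq deg_D)
  then have "degree (p\<^sup>2) = 2 * (d + degree q)"
    using D_nz q_nz by (simp add: degree_mult_eq degree_power_eq deg_D)
  moreover have "p \<noteq> 0" using calculation d_pos by auto
  ultimately show ?thesis by (simp add: degree_power_eq)
qed

lemma p_nz: "p \<noteq> 0"
  using degree_p d_pos by auto

text \<open>As \<open>nu\<close> is a unit, the Pell equation is a Bezout identity making
  \<open>p\<close> and \<open>q\<close> coprime.\<close>

lemma p_dvd_q_mult:
  assumes "p dvd q * y"
  shows "p dvd y"
proof -
  have "p dvd D * q * (q * y)" using assms by simp
  moreover have "[:nu:] * y = p * (p * y) - D * q * (q * y)"
    using pell by algebra
  ultimately have "p dvd [:nu:] * y" by (metis dvd_diff dvd_triv_left)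
  then show ?thesis using nu by (simp add: dvd_smult_iff)
qed

lemma q_dvd_mult_p:
  assumes "q dvd y * p"
  shows "q dvd y"
proof -
  have "q dvd y * p * p" using assms by simp
  moreover have "[:nu:] * y = y * p * p - q * (D * q * y)"
    using pell by algebra
  ultimately have "q dvd [:nu:] * y" by (metis dvd_diff dvd_triv_left)
  then show ?thesis using nu by (simp add: dvd_smult_iff)
qed

text \<open>The fraction \<open>q/p\<close> is as badly approximable as \<open>1 / sqrt D\<close>: writing \<open>p * w = u + q * y\<close>,
  a smaller \<open>u\<close> would make the degree of \<open>y\<^sup>2 - D * w\<^sup>2\<close> negative.\<close>

lemma degree_residue_ge:
  assumes "p dvd u + q * y" and y: "y \<noteq> 0" and dy: "degree y < degree p"
  shows "u \<noteq> 0 \<and> degree p \<le> degree u + d + degree y"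
proof (intro conjI)
  show u: "u \<noteq> 0"
  proof
    assume "u = 0"
    then have "p dvd q * y" using assms(1) by simp
    then have "p dvd y" by (rule p_dvd_q_mult)
    then show False using dvd_imp_degree_le[of p y] y dy by simp
  qed
  obtain w where w: "u + q * y = p * w" using assms(1) by (auto simp: dvd_def)
  show "degree p \<le> degree u + d + degree y"
  proof (rule ccontr)
    assume less: "\<not> ?thesis"
    have dq: "degree p = degree q + d" by (rule degree_p)
    have "p\<^sup>2 * (y\<^sup>2 - D * w\<^sup>2) = (D * q\<^sup>2 + [:nu:]) * y\<^sup>2 - D * (p * w)\<^sup>2"
      unfolding pell[symmetric] by algebra
    \<comment> \<open>The dominant term \<open>D * q^2 * y^2\<close> cancels here; each of the three
      remaining terms has degree below \<open>2 * degree p\<close>.\<close>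
    also have "\<dots> = [:nu:] * y\<^sup>2 - 2 * (D * q * u * y) - D * u\<^sup>2"
      unfolding w[symmetric] by algebra
    finally have eq: "p\<^sup>2 * (y\<^sup>2 - D * w\<^sup>2) = [:nu:] * y\<^sup>2 - 2 * (D * q * u * y) - D * u\<^sup>2" .
    have "degree ([:nu:] * y\<^sup>2) < 2 * degree p"
      using dy y nu by (simp add: degree_power_eq)
    moreover have "degree (2 * (D * q * u * y)) < 2 * degree p"
    proof -
      have "degree (D * q * u * y) < 2 * degree p"
        using less D_nz q_nz u y dq by (simp add: degree_mult_eq deg_D)
      then show ?thesis by (metis degree_add_less mult_2)
    qed
    moreover have "degree (D * u\<^sup>2) < 2 * degree p"
      using less D_nz u by (simp add: degree_mult_eq degree_power_eq deg_D)
    ultimately have "degree (p\<^sup>2 * (y\<^sup>2 - D * w\<^sup>2)) < 2 * degree p"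
      unfolding eq by (intro degree_diff_less)
    then have "y\<^sup>2 = D * w\<^sup>2"
      using p_nz by (cases "y\<^sup>2 - D * w\<^sup>2 = 0") (simp_all add: degree_mult_eq degree_power_eq)
    then have "w = 0" by (rule nonsquare_irrational[OF nonsq])
    then show False using \<open>y\<^sup>2 = D * w\<^sup>2\<close> y by simp
  qed
qed

text \<open>Both Vieta involutions \<open>u \<mapsto> - u - 2 p y\<close> and \<open>y \<mapsto> - y - 2 p u / nu\<close> preserve the form but flip the
  sign in the congruence between \<open>u\<close> and \<open>q * y\<close>; hence the disjunction.\<close>

lemma degree_form_ge:
  assumes "p dvd u + q * y \<or> p dvd u - q * y" and "u \<noteq> 0 \<or> y \<noteq> 0"
  shows "2 * degree p \<le> degree (u\<^sup>2 + 2 * p * u * y + [:nu:] * y\<^sup>2) + d"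
  using assms
proof (induction "degree y" arbitrary: u y rule: less_induct)
  case less
  let ?F = "\<lambda>u y. u\<^sup>2 + 2 * p * u * y + [:nu:] * y\<^sup>2"
  show ?case
  proof (cases "y = 0")
    case True
    then have "p dvd u" "u \<noteq> 0" using less.prems by auto
    then have "degree p \<le> degree u" by (simp add: dvd_imp_degree_le)
    then show ?thesis using True \<open>u \<noteq> 0\<close> by (simp add: degree_power_eq)
  next
    case y: False
    \<comment> \<open>The first involution exchanges \<open>u\<close> and
      \<open>v = - u - 2 * p * y\<close>. It suffices to treat the one of smaller degree, for then
      \<open>v\<close> has at least the degree of \<open>p * y\<close>.\<close>
    have main: "2 * degree p \<le> degree (?F u y) + d"
      if cong: "p dvd u + q * y \<or> p dvd u - q * y"
        and le: "degree u \<le> degree (- u - 2 * p * y)" for u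
    proof (rule ccontr)
      assume small: "\<not> 2 * degree p \<le> degree (?F u y) + d"
      define v where "v = - u - 2 * p * y"
      have F: "?F u y = [:nu:] * y\<^sup>2 - u * v" unfolding v_def by algebra
      have d_py: "degree (2 * p * y) = degree p + degree y"
        using p_nz y two_poly degree_mult_eq[of "2 * p" y] degree_mult_eq[of 2 p]
        by (simp add: numeral_poly)
      have dv: "degree p + degree y \<le> degree v"
      proof (rule ccontr)
        assume "\<not> ?thesis"
        then have "degree (u + v) < degree p + degree y"
          using le unfolding v_def by (intro degree_add_less) auto
        moreover have "u + v = - (2 * p * y)" unfolding v_def by simp
        ultimately show False using d_py by (simp del: mult_minus_left mult_minus_right)
      qed
      then have v: "v \<noteq> 0" using degree_p d_pos by auto
      show False
      proof (cases "degree y < degree p")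
        case True
        have "u \<noteq> 0 \<and> degree p \<le> degree u + d + degree y"
        proof (cases "p dvd u + q * y")
          case True
          then show ?thesis using degree_residue_ge y \<open>degree y < degree p\<close> by blast
        next
          case False
          then have "p dvd u + q * (- y)" using cong by simp
          then show ?thesis using degree_residue_ge[of u "- y"] y \<open>degree y < degree p\<close> by simp
        qed
        then have "u \<noteq> 0" and "degree p \<le> degree u + d + degree y" by auto
        moreover have duv: "degree (u * v) = degree u + degree v"
          using v \<open>u \<noteq> 0\<close> by (simp add: degree_mult_eq)
        moreover have "degree ([:nu:] * y\<^sup>2) = 2 * degree y"
          using y nu by (simp add: degree_power_eq)
        \<comment> \<open>\<open>degree v\<close> alone is at least
          \<open>degree p + degree y\<close>, more than the degree of \<open>[:nu:] * y^2\<close>,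
          so \<open>u * v\<close> dominates.\<close>
        ultimately have "degree (?F u y) = degree (u * v)"
          unfolding F using dv True
          by (subst diff_conv_add_uminus, subst degree_add_eq_right) auto
        then show False
          using small duv dv \<open>degree p \<le> degree u + d + degree y\<close> by linarith
      next
        case False
        \<comment> \<open>The second involution: \<open>z\<close> is the other solution in
          \<open>y\<close> of the quadratic equation fixing \<open>u\<close> and the value of the
          form. By Vieta \<open>nu * y * z\<close> is \<open>u^2\<close> minus that value, which
          forces \<open>z\<close> to be smaller than \<open>y\<close>.\<close>
        define z where "z = - y - smult (2 / nu) (p * u)"
        have nuz: "[:nu:] * z = - ([:nu:] * y) - 2 * p * u"
          unfolding z_def using nu by (simp add: algebra_simps numeral_poly)
        have "[:nu:] * ?F u z = [:nu:] * u\<^sup>2 + 2 * p * u * ([:nu:] * z) + ([:nu:] * z)\<^sup>2"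
          by algebra
        also have "\<dots> = [:nu:] * ?F u y" unfolding nuz by algebra
        finally have "[:nu:] * ?F u z = [:nu:] * ?F u y" .
        moreover have "[:nu:] \<noteq> 0" using nu by simp
        ultimately have Fz: "?F u z = ?F u y" using mult_left_cancel by blast
        have yz: "y * ([:nu:] * z) = u\<^sup>2 - ?F u y" unfolding nuz by algebra
        \<comment> \<open>By \<open>small\<close> the value of the form has degree below
          \<open>2 * degree p\<close>, hence below \<open>2 * degree y\<close>. So
          \<open>u * v\<close> has degree at most \<open>2 * degree y\<close>, of which
          \<open>v\<close> takes at least \<open>degree p + degree y\<close>.\<close>
        have du: "degree u + degree p \<le> degree y"
        proof (cases "u = 0")
          case True
          then show ?thesis using False by simp
        next
          case u: False
          have "degree (u * v) \<le> 2 * degree y"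
          proof -
            have "u * v = [:nu:] * y\<^sup>2 - ?F u y" unfolding F by simp
            moreover have "degree ([:nu:] * y\<^sup>2) \<le> 2 * degree y"
              using y nu by (simp add: degree_power_eq)
            moreover have "degree (?F u y) \<le> 2 * degree y" using small False by linarith
            ultimately show ?thesis by (metis degree_diff_le)
          qed
          then show ?thesis using u v dv by (simp add: degree_mult_eq)
        qed
        have z: "z = 0 \<or> degree z < degree y"
        proof (cases "z = 0")
          case z: False
          have "degree p > 0" using degree_p d_pos by simp
          then have "degree (u\<^sup>2) < 2 * degree y"
            using du degree_power_le[of u 2] by linarith
          moreover have "degree (?F u y) < 2 * degree y" using small False d_pos by linarith
          ultimately have "degree (u\<^sup>2 - ?F u y) < 2 * degree y" by (rule degree_diff_less)
          moreover have "degree (y * ([:nu:] * z)) = degree y + degree z"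
            using y z nu by (simp add: degree_mult_eq)
          ultimately show ?thesis unfolding yz by simp
        qed simp
        have cong_z: "p dvd u + q * z \<or> p dvd u - q * z"
        proof -
          have "u - q * z = u + q * y + p * smult (2 / nu) (q * u)"
            "u + q * z = u - q * y - p * smult (2 / nu) (q * u)"
            unfolding z_def by (simp_all add: algebra_simps)
          then show ?thesis using cong by (metis dvd_add dvd_diff dvd_triv_left)
        qed
        have "2 * degree p \<le> degree (?F u z) + d"
        proof (cases "z = 0")
          case True
          have "y \<noteq> 0 \<Longrightarrow> u \<noteq> 0"
            using nuz True nu by auto
          then have "p dvd u" "u \<noteq> 0" using cong_z True y by auto
          then have "degree p \<le> degree u" by (simp add: dvd_imp_degree_le)
          then show ?thesis using True \<open>u \<noteq> 0\<close> by (simp add: degree_power_eq)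
        next
          case False
          then show ?thesis using less.hyps[of z u] z cong_z by blast
        qed
        then show False using small unfolding Fz by blast
      qed
    qed
    show ?thesis
    proof (cases "degree u \<le> degree (- u - 2 * p * y)")
      case True
      then show ?thesis using main less.prems by blast
    next
      case False
      let ?v = "- u - 2 * p * y"
      have "?v + q * y = p * (- 2 * y) - (u - q * y)" "?v - q * y = p * (- 2 * y) - (u + q * y)"
        by algebra+
      then have "p dvd ?v + q * y \<or> p dvd ?v - q * y"
        using less.prems(1) dvd_diff[OF dvd_triv_left] by metis
      moreover have "- ?v - 2 * p * y = u" by simp
      ultimately have "2 * degree p \<le> degree (?F ?v y) + d"
        using main[of ?v] False by simp
      moreover have "?F ?v y = ?F u y" by algebra
      ultimately show ?thesis by simp
    qed
  qed
qed

end

section \<open>Polynomials inside the Laurent series\<close>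

lemma poly_to_L_0 [simp]: "poly_to_L 0 = 0"
  by (simp add: poly_to_L_def)

lemma poly_to_L_const [simp]: "poly_to_L [:c:] = fls_const c"
  by (simp add: poly_to_L_pCons)

lemma poly_to_L_1 [simp]: "poly_to_L 1 = 1"
  by (simp add: one_pCons)

lemma poly_to_L_add [simp]: "poly_to_L (p + q) = poly_to_L p + poly_to_L q"
  by (rule fls_eqI) (simp add: poly_to_L_nth)

lemma poly_to_L_minus [simp]: "poly_to_L (- p) = - poly_to_L p"
  by (rule fls_eqI) (simp add: poly_to_L_nth)

lemma poly_to_L_diff [simp]: "poly_to_L (p - q) = poly_to_L p - poly_to_L q"
  by (rule fls_eqI) (simp add: poly_to_L_nth)

lemma poly_to_L_smult: "poly_to_L (smult c p) = fls_const c * poly_to_L p"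
  by (rule fls_eqI) (simp add: poly_to_L_nth)

lemma poly_to_L_mult [simp]: "poly_to_L (p * q) = poly_to_L p * poly_to_L q"
  by (induction p) (simp_all add: poly_to_L_pCons poly_to_L_smult algebra_simps)

lemma poly_to_L_power [simp]: "poly_to_L (p ^ n) = poly_to_L p ^ n"
  by (induction n) simp_all

lemma poly_to_L_numeral [simp]: "poly_to_L (numeral n) = numeral n"
  by (simp add: numeral_poly fls_const_numeral)

lemma poly_to_L_eq_iff [simp]: "poly_to_L p = poly_to_L q \<longleftrightarrow> p = q"
  by (metis poly_part_poly_to_L)

lemma poly_to_L_eq_0_iff [simp]: "poly_to_L p = 0 \<longleftrightarrow> p = 0"
  using poly_to_L_eq_iff[of p 0] by simp

text \<open>Sign convention for all that follows: the subdegree counts powers of 1/T, so an upper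
  bound on a subdegree is a lower bound on a degree.\<close>

lemma fls_subdegree_poly_to_L: "fls_subdegree (poly_to_L p) = - int (degree p)"
proof (cases "p = 0")
  case False
  then show ?thesis
    by (intro fls_subdegree_eqI) (auto simp: poly_to_L_nth coeff_eq_0)
qed simp

lemma fls_subdegree_minus_poly_part:
  assumes "f \<noteq> poly_to_L (poly_part f)"
  shows "fls_subdegree (f - poly_to_L (poly_part f)) > 0"
  using assms by (intro fls_subdegree_greaterI) (auto simp: poly_to_L_nth poly_part_nth)

lemma degree_poly_part_le: "int (degree (poly_part f)) \<le> max 0 (- fls_subdegree f)"
proof -
  have "degree (poly_part f) \<le> nat (max 0 (- fls_subdegree f))"
    by (rule degree_le) (auto simp: poly_part_nth)
  then show ?thesis by linarith
qed

lemma fls_subdegree_divide: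
  fixes f g :: "'a::field fls"
  assumes "f \<noteq> 0" "g \<noteq> 0"
  shows "fls_subdegree (f / g) = fls_subdegree f - fls_subdegree g"
proof -
  have "fls_subdegree (f / g * g) = fls_subdegree (f / g) + fls_subdegree g"
    using assms by (intro fls_subdegree_mult) auto
  then show ?thesis using assms by simp
qed

section \<open>Bounding the partial quotients by the values of a quadratic form\<close>

text \<open>In the applications \<open>\<alpha>'\<close> is the conjugate of
  \<open>\<alpha>\<close>. Nonvanishing is demanded separately because
  \<open>fls_subdegree 0 = 0\<close>.\<close>

definition well_spaced :: "nat \<Rightarrow> 'a::field fls \<Rightarrow> 'a fls \<Rightarrow> bool" where
  "well_spaced d \<alpha> \<alpha>' \<longleftrightarrow> \<alpha> \<noteq> \<alpha>' \<and> (\<forall>x y. x \<noteq> 0 \<or> y \<noteq> 0 \<longrightarrow>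
     (let v = (poly_to_L x - \<alpha> * poly_to_L y) * (poly_to_L x - \<alpha>' * poly_to_L y)
      in v \<noteq> 0 \<and> fls_subdegree v \<le> fls_subdegree (\<alpha> - \<alpha>') + int d))"

lemma well_spacedD:
  assumes "well_spaced d \<alpha> \<alpha>'" and "x \<noteq> 0 \<or> y \<noteq> 0"
  shows "(poly_to_L x - \<alpha> * poly_to_L y) * (poly_to_L x - \<alpha>' * poly_to_L y) \<noteq> 0"
    and "fls_subdegree ((poly_to_L x - \<alpha> * poly_to_L y) * (poly_to_L x - \<alpha>' * poly_to_L y))
           \<le> fls_subdegree (\<alpha> - \<alpha>') + int d"
  using assms unfolding well_spaced_def Let_def by blast+

text \<open>The new form at \<open>(x, y)\<close> is the old one at \<open>(y + c * x, x)\<close>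
  divided by \<open>(\<alpha> - c) * (\<alpha>' - c)\<close>. The difference of the two elements
  changes by the same factor up to sign, so the bound is invariant.\<close>

lemma well_spaced_step:
  assumes ws: "well_spaced d \<alpha> \<alpha>'"
  shows "\<alpha> \<noteq> poly_to_L c" and "\<alpha>' \<noteq> poly_to_L c"
    and "well_spaced d (1 / (\<alpha> - poly_to_L c)) (1 / (\<alpha>' - poly_to_L c))"
proof -
  show a: "\<alpha> \<noteq> poly_to_L c" and a': "\<alpha>' \<noteq> poly_to_L c"
    using well_spacedD(1)[OF ws, of c 1] by auto
  let ?A = "\<alpha> - poly_to_L c" and ?A' = "\<alpha>' - poly_to_L c"
  have nz: "?A \<noteq> 0" "?A' \<noteq> 0" using a a' by auto
  have ne: "\<alpha> - \<alpha>' \<noteq> 0" using ws by (simp add: well_spaced_def)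
  have diff: "1 / ?A - 1 / ?A' = - (\<alpha> - \<alpha>') / (?A * ?A')"
    using nz by (simp add: field_simps)
  have sdiff: "fls_subdegree (1 / ?A - 1 / ?A') =
      fls_subdegree (\<alpha> - \<alpha>') - fls_subdegree (?A * ?A')"
    unfolding diff using nz ne by (subst fls_subdegree_divide) (auto simp: fls_subdegree_minus_sym)
  show "well_spaced d (1 / ?A) (1 / ?A')"
    unfolding well_spaced_def
  proof (intro conjI allI impI)
    show "1 / ?A \<noteq> 1 / ?A'" using nz ne by (simp add: field_simps)
    fix x y :: "'a poly" assume "x \<noteq> 0 \<or> y \<noteq> 0"
    then have xy: "y + c * x \<noteq> 0 \<or> x \<noteq> 0" by auto
    define w where "w = (poly_to_L (y + c * x) - \<alpha> * poly_to_L x)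
      * (poly_to_L (y + c * x) - \<alpha>' * poly_to_L x)"
    have "(poly_to_L x - 1 / ?A * poly_to_L y) * (poly_to_L x - 1 / ?A' * poly_to_L y)
        = (?A * poly_to_L x - poly_to_L y) / ?A * ((?A' * poly_to_L x - poly_to_L y) / ?A')"
      using nz by (simp add: diff_divide_distrib)
    also have "\<dots> = w / (?A * ?A')"
      unfolding w_def by (simp add: algebra_simps)
    finally have eq: "(poly_to_L x - 1 / ?A * poly_to_L y) * (poly_to_L x - 1 / ?A' * poly_to_L y)
      = w / (?A * ?A')" .
    have w: "w \<noteq> 0" "fls_subdegree w \<le> fls_subdegree (\<alpha> - \<alpha>') + int d"
      unfolding w_def using well_spacedD[OF ws xy] by blast+
    show "let v = (poly_to_L x - 1 / ?A * poly_to_L y) * (poly_to_L x - 1 / ?A' * poly_to_L y)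
      in v \<noteq> 0 \<and> fls_subdegree v \<le> fls_subdegree (1 / ?A - 1 / ?A') + int d"
      unfolding Let_def eq sdiff using w nz by (simp add: fls_subdegree_divide del: fls_subdegree_mult)
  qed
qed

text \<open>If \<open>\<gamma> - \<gamma>'\<close> has degree at least 0, removing the polynomial
  part of \<open>\<gamma>\<close> leaves a conjugate of degree at least 0. After inversion the
  quotient has positive degree and its conjugate does not, so their difference has the degree of the
  quotient.\<close>

lemma complete_quotient_well_spaced:
  assumes "well_spaced d \<alpha> \<alpha>'" and "fls_subdegree (\<alpha> - \<alpha>') \<le> 0"
    and "complete_quotient \<alpha> n = Some \<beta>"
  shows "\<exists>\<beta>'. well_spaced d \<beta> \<beta>' \<and> fls_subdegree (\<beta> - \<beta>') \<le> 0 \<and>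
    (n > 0 \<longrightarrow> fls_subdegree (\<beta> - \<beta>') = fls_subdegree \<beta>)"
  using assms(3)
proof (induction n arbitrary: \<beta>)
  case 0
  then show ?case using assms by auto
next
  case (Suc n)
  then obtain \<gamma> where \<gamma>: "complete_quotient \<alpha> n = Some \<gamma>"
    by (auto split: option.splits)
  define a where "a = poly_to_L (poly_part \<gamma>)"
  have ne: "\<gamma> \<noteq> a" and \<beta>: "\<beta> = 1 / (\<gamma> - a)"
    using Suc.prems \<gamma> by (auto simp: a_def split: if_splits)
  obtain \<gamma>' where ws: "well_spaced d \<gamma> \<gamma>'" and le: "fls_subdegree (\<gamma> - \<gamma>') \<le> 0"
    using Suc.IH \<gamma> by blast
  have pos: "fls_subdegree (\<gamma> - a) > 0"
    using fls_subdegree_minus_poly_part ne unfolding a_def by blast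
  have "fls_subdegree (\<gamma>' - a) = fls_subdegree (\<gamma>' - \<gamma>)"
  proof -
    have "\<gamma>' - \<gamma> \<noteq> 0" using ws by (auto simp: well_spaced_def)
    moreover have "fls_subdegree (\<gamma>' - \<gamma>) < fls_subdegree (\<gamma> - a)"
      using le pos fls_subdegree_minus_sym[of \<gamma> \<gamma>'] by linarith
    ultimately have "fls_subdegree ((\<gamma>' - \<gamma>) + (\<gamma> - a)) = fls_subdegree (\<gamma>' - \<gamma>)"
      by (rule fls_subdegree_add_eq1)
    then show ?thesis by simp
  qed
  then have le': "fls_subdegree (\<gamma>' - a) \<le> 0"
    using le fls_subdegree_minus_sym[of \<gamma> \<gamma>'] by simp
  have ws1: "well_spaced d \<beta> (1 / (\<gamma>' - a))" and ne': "\<gamma>' \<noteq> a"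
    unfolding \<beta> a_def using well_spaced_step[OF ws] by blast+
  have s\<beta>: "fls_subdegree \<beta> < 0" and \<beta>0: "\<beta> \<noteq> 0"
    unfolding \<beta> using ne pos by (simp_all add: fls_subdegree_divide)
  have s\<beta>': "fls_subdegree (1 / (\<gamma>' - a)) \<ge> 0"
    using ne' le' by (simp add: fls_subdegree_divide)
  have "fls_subdegree (\<beta> - 1 / (\<gamma>' - a)) = fls_subdegree \<beta>"
    using s\<beta> s\<beta>' \<beta>0 by (intro fls_subdegree_diff_eq1) auto
  then show ?case using ws1 s\<beta> by (intro exI[of _ "1 / (\<gamma>' - a)"]) simp
qed

lemma K_sup_le_if_well_spaced:
  assumes "well_spaced d \<alpha> \<alpha>'" and "fls_subdegree (\<alpha> - \<alpha>') \<le> 0"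
  shows "K_sup \<alpha> \<le> enat d"
  unfolding K_sup_def
proof (rule Sup_least, clarify)
  fix a :: "'a poly" and j :: nat
  assume "1 \<le> j" and "partial_quotient \<alpha> j = Some a"
  then obtain \<beta> where \<beta>: "complete_quotient \<alpha> j = Some \<beta>" and a: "a = poly_part \<beta>"
    by (auto simp: partial_quotient_def)
  obtain \<beta>' where ws: "well_spaced d \<beta> \<beta>'" and "fls_subdegree (\<beta> - \<beta>') = fls_subdegree \<beta>"
    using complete_quotient_well_spaced[OF assms \<beta>] \<open>1 \<le> j\<close> by auto
  \<comment> \<open>The form takes the value 1 at \<open>(1, 0)\<close>, whose subdegree is
    0.\<close>
  then have "- fls_subdegree \<beta> \<le> int d"
    using well_spacedD(2)[OF ws, of 1 0] by simp
  then show "enat (degree a) \<le> enat d"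
    using degree_poly_part_le[of \<beta>] unfolding a by simp
qed

section \<open>The field generated by \<open>T\<close> and a square root\<close>

lemma is_subfield_adjoin_T: "is_subfield (adjoin_T s)"
  unfolding adjoin_T_def is_subfield_def by blast

lemma subfield_divide:
  assumes "is_subfield F" "x \<in> F" "y \<in> F"
  shows "x / y \<in> F"
  using assms unfolding is_subfield_def divide_inverse by blast

lemma subfield_minus:
  assumes "is_subfield F" "x \<in> F"
  shows "- x \<in> F"
  using assms unfolding is_subfield_def by (metis diff_0)

lemma subfield_add:
  assumes "is_subfield F" "x \<in> F" "y \<in> F"
  shows "x + y \<in> F"
  using assms subfield_minus unfolding is_subfield_def by (metis diff_minus_eq_add)

lemma self_in_adjoin_T: "s \<in> adjoin_T s"
  by (auto simp: adjoin_T_def)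

lemma poly_to_L_in_adjoin_T: "poly_to_L p \<in> adjoin_T s"
proof (induction p)
  case 0
  show ?case using is_subfield_adjoin_T[of s] by (simp add: is_subfield_def)
next
  case (pCons a p)
  have "fls_const a \<in> adjoin_T s" "fls_X_inv \<in> adjoin_T s" by (auto simp: adjoin_T_def)
  then show ?case
    using pCons is_subfield_adjoin_T[of s] subfield_add[OF is_subfield_adjoin_T[of s]]
    unfolding poly_to_L_pCons is_subfield_def by blast
qed

section \<open>Equivalence\<close>

text \<open>Cross-multiplied, so that the relation is visibly symmetric and needs no nonvanishing denominator.\<close>

definition moebius_related :: "'a::field fls \<Rightarrow> 'a fls \<Rightarrow> bool" where
  "moebius_related \<alpha> \<beta> \<longleftrightarrow> (\<exists>a b c e. (a * e - b * c) dvd 1 \<and>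
     poly_to_L c * \<alpha> * \<beta> + poly_to_L e * \<beta> = poly_to_L a * \<alpha> + poly_to_L b)"

lemma moebius_related_refl: "moebius_related \<alpha> \<alpha>"
  unfolding moebius_related_def
  by (rule exI[of _ 1], rule exI[of _ 0], rule exI[of _ 0], rule exI[of _ 1]) simp

lemma moebius_related_sym:
  assumes "moebius_related \<alpha> \<beta>"
  shows "moebius_related \<beta> \<alpha>"
proof -
  obtain a b c e where abce: "(a * e - b * c) dvd 1"
    "poly_to_L c * \<alpha> * \<beta> + poly_to_L e * \<beta> = poly_to_L a * \<alpha> + poly_to_L b"
    using assms unfolding moebius_related_def by blast
  \<comment> \<open>The inverse transformation is given by the negated adjugate matrix, which has
    the same determinant.\<close>
  have "((- e) * (- a) - b * c) dvd 1"
    using abce(1) by (simp add: mult.commute)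
  moreover have "poly_to_L c * \<beta> * \<alpha> + poly_to_L (- a) * \<alpha> = poly_to_L (- e) * \<beta> + poly_to_L b"
    using abce(2) unfolding poly_to_L_minus by algebra
  ultimately show ?thesis unfolding moebius_related_def by blast
qed

lemma cf_equivalent_imp_moebius_related:
  assumes "cf_equivalent \<alpha> \<beta>"
  shows "moebius_related \<alpha> \<beta>"
proof -
  obtain M :: "'a poly ^ 2 ^ 2" where "invertible M"
    and nz: "poly_to_L (M $ 2 $ 1) * \<alpha> + poly_to_L (M $ 2 $ 2) \<noteq> 0"
    and \<beta>: "\<beta> = (poly_to_L (M $ 1 $ 1) * \<alpha> + poly_to_L (M $ 1 $ 2))
            / (poly_to_L (M $ 2 $ 1) * \<alpha> + poly_to_L (M $ 2 $ 2))"
    using assms unfolding cf_equivalent_def by blast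
  then obtain M' where "M ** M' = mat 1" by (auto simp: invertible_def)
  then have "det M * det M' = 1" by (metis det_I det_mul)
  then have "det M dvd 1" by (metis dvd_triv_left)
  moreover have "poly_to_L (M $ 2 $ 1) * \<alpha> * \<beta> + poly_to_L (M $ 2 $ 2) * \<beta>
      = poly_to_L (M $ 1 $ 1) * \<alpha> + poly_to_L (M $ 1 $ 2)"
  proof -
    have "\<beta> * (poly_to_L (M $ 2 $ 1) * \<alpha> + poly_to_L (M $ 2 $ 2))
        = poly_to_L (M $ 1 $ 1) * \<alpha> + poly_to_L (M $ 1 $ 2)"
      using nz by (simp add: \<beta>)
    then show ?thesis by (simp add: algebra_simps)
  qed
  ultimately show ?thesis unfolding moebius_related_def det_2 by blast
qed

lemma clear_denominators:
  fixes a b c e t u v w :: "'b::field"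
  assumes "c * (u / t) * (v / w) + e * (v / w) = a * (u / t) + b" and "t \<noteq> 0" "w \<noteq> 0"
  shows "c * u * v + e * v * t = a * u * w + b * w * t"
proof -
  have "c * u * v + e * v * t = (c * (u / t) * (v / w) + e * (v / w)) * (t * w)"
    using assms(2,3) by (simp add: field_simps)
  also have "\<dots> = a * u * w + b * w * t"
    unfolding assms(1) using assms(2,3) by (simp add: field_simps)
  finally show ?thesis .
qed

lemma infinite_inequivalent_family:
  assumes "infinite I"
    and "\<And>i. i \<in> I \<Longrightarrow> f i \<in> F \<and> K_sup (f i) \<le> b"
    and rel: "\<And>i j. i \<in> I \<Longrightarrow> j \<in> I \<Longrightarrow> i \<noteq> j \<Longrightarrow> \<not> moebius_related (f i) (f j)"
  shows "\<exists>A \<subseteq> F. infinite A \<and> (\<forall>\<alpha>\<in>A. K_sup \<alpha> \<le> b)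
           \<and> (\<forall>\<alpha>\<in>A. \<forall>\<beta>\<in>A. \<alpha> \<noteq> \<beta> \<longrightarrow> \<not> cf_equivalent \<alpha> \<beta>)"
proof (intro exI conjI ballI impI)
  have "inj_on f I"
    using rel moebius_related_refl by (metis inj_onI)
  then show "infinite (f ` I)" using assms(1) finite_imageD by blast
  show "f ` I \<subseteq> F" using assms(2) by blast
  fix \<alpha> assume \<alpha>: "\<alpha> \<in> f ` I"
  then show "K_sup \<alpha> \<le> b" using assms(2) by blast
  fix \<beta> assume "\<beta> \<in> f ` I" "\<alpha> \<noteq> \<beta>"
  then show "\<not> cf_equivalent \<alpha> \<beta>"
    using \<alpha> rel cf_equivalent_imp_moebius_related by blast
qed

section \<open>The square root of \<open>D\<close>\<close>

text \<open>Used to split one equation over K(T, s) into two polynomial equations.\<close>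

lemma sqrt_linear_independent:
  assumes "nonsquare D" and s: "s\<^sup>2 = poly_to_L D"
    and zero: "poly_to_L a + poly_to_L b * s = 0"
  shows "a = 0" and "b = 0"
proof -
  have "poly_to_L a = - (poly_to_L b * s)" using zero by (simp add: eq_neg_iff_add_eq_0)
  then have "poly_to_L (a\<^sup>2) = poly_to_L (D * b\<^sup>2)"
    by (simp add: power_mult_distrib s)
  then have eq: "a\<^sup>2 = D * b\<^sup>2" by (simp only: poly_to_L_eq_iff)
  then show "b = 0" by (rule nonsquare_irrational[OF assms(1)])
  then show "a = 0" using eq by simp
qed

lemma fls_subdegree_sqrt:
  assumes "s\<^sup>2 = poly_to_L D" and "degree D = 2 * d"
  shows "fls_subdegree s = - int d"
  using arg_cong[OF assms(1), of fls_subdegree] assms(2)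
  by (simp add: fls_subdegree_pow fls_subdegree_poly_to_L)

lemma numeral_2_fls_nonzero:
  assumes "(2::'a::field) \<noteq> 0"
  shows "(2::'a fls) \<noteq> 0"
  using assms by (metis fls_const_0 fls_const_numeral fls_const_nth)

section \<open>Discriminants with trivial Pell equation\<close>

text \<open>The values of the form are \<open>N / t^2\<close> with
  \<open>N = (t * x)^2 - D * y^2\<close>. \<open>N\<close> is never constant: by
  \<open>nonpell\<close> if \<open>y\<close> is nonzero, and as a nonzero multiple of
  \<open>t^2\<close> otherwise. So the values have degree at least -1, which is exactly
  \<open>(d - 1) - d\<close>.\<close>

lemma well_spaced_sqrt_over_linear:
  fixes D :: "'a::field poly"
  assumes two: "(2::'a) \<noteq> 0" and "d > 0" and deg: "degree D = 2 * d"
    and s: "s\<^sup>2 = poly_to_L D"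
    and nonpell: "\<And>p q. q \<noteq> 0 \<Longrightarrow> degree (p\<^sup>2 - D * q\<^sup>2) \<noteq> 0"
    and t: "degree t = 1"
  shows "well_spaced d (s / poly_to_L t) (- s / poly_to_L t)"
    and "fls_subdegree (s / poly_to_L t - - s / poly_to_L t) \<le> 0"
proof -
  have "D \<noteq> 0" using deg \<open>d > 0\<close> by auto
  then have s0: "s \<noteq> 0" using s by auto
  have t0: "t \<noteq> 0" using t by auto
  have diff: "s / poly_to_L t - - s / poly_to_L t = 2 * s / poly_to_L t" by simp
  have nz: "2 * s \<noteq> 0" using numeral_2_fls_nonzero[OF two] s0 by simp
  have sdiff: "fls_subdegree (s / poly_to_L t - - s / poly_to_L t) = 1 - int d"
    unfolding diff using nz t0
    by (simp add: fls_subdegree_divide fls_subdegree_poly_to_L fls_subdegree_sqrt[OF s deg] t)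
  then show "fls_subdegree (s / poly_to_L t - - s / poly_to_L t) \<le> 0"
    using \<open>d > 0\<close> by simp
  show "well_spaced d (s / poly_to_L t) (- s / poly_to_L t)"
    unfolding well_spaced_def
  proof (intro conjI allI impI)
    show "s / poly_to_L t \<noteq> - s / poly_to_L t" using nz t0 diff by (auto simp: field_simps)
    fix x y :: "'a poly" assume xy: "x \<noteq> 0 \<or> y \<noteq> 0"
    define N where "N = (t * x)\<^sup>2 - D * y\<^sup>2"
    have eq: "(poly_to_L x - s / poly_to_L t * poly_to_L y) * (poly_to_L x - - s / poly_to_L t * poly_to_L y)
      = poly_to_L N / poly_to_L (t\<^sup>2)" (is "?v = _")
      unfolding N_def using t0
      by (simp add: field_simps power2_eq_square s[symmetric])
    have "degree N > 0"
    proof (cases "y = 0")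
      case True
      then show ?thesis unfolding N_def using xy t0 t by (simp add: degree_power_eq degree_mult_eq)
    qed (use nonpell N_def in blast)
    moreover have "N \<noteq> 0" using \<open>degree N > 0\<close> by auto
    moreover have "fls_subdegree ?v = 2 - int (degree N)"
      unfolding eq using \<open>N \<noteq> 0\<close> t0 t
      by (subst fls_subdegree_divide) (simp_all add: fls_subdegree_poly_to_L degree_power_eq del: poly_to_L_power)
    moreover have "?v \<noteq> 0" unfolding eq using \<open>N \<noteq> 0\<close> t0 by simp
    ultimately show "let v = ?v in
        v \<noteq> 0 \<and> fls_subdegree v \<le> fls_subdegree (s / poly_to_L t - - s / poly_to_L t) + int d"
      unfolding Let_def sdiff by linarith
  qed
qed

text \<open>Comparing coefficients of 1 and \<open>s\<close> gives \<open>c * D = b * t * u\<close>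
  and \<open>e * t = a * u\<close>. At the root \<open>l\<close> of \<open>t\<close> these force
  \<open>c\<close> and \<open>a\<close> to vanish, and with them the determinant, which is a
  unit.\<close>

lemma sqrt_over_linear_not_moebius_related:
  fixes D :: "'a::field poly"
  assumes ns: "nonsquare D" and s: "s\<^sup>2 = poly_to_L D"
    and "poly D l \<noteq> 0" and "l \<noteq> m"
  shows "\<not> moebius_related (s / poly_to_L [:- l, 1:]) (s / poly_to_L [:- m, 1:])"
proof
  define t u where "t = [:- l, 1:]" and "u = [:- m, 1:]"
  have t0: "poly_to_L t \<noteq> 0" "poly_to_L u \<noteq> 0" by (simp_all add: t_def u_def)
  assume "moebius_related (s / poly_to_L [:- l, 1:]) (s / poly_to_L [:- m, 1:])"
  then obtain a b c e where unit: "(a * e - b * c) dvd 1"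
    and rel: "poly_to_L c * (s / poly_to_L t) * (s / poly_to_L u) + poly_to_L e * (s / poly_to_L u)
      = poly_to_L a * (s / poly_to_L t) + poly_to_L b"
    unfolding moebius_related_def t_def u_def by blast
  have "poly_to_L c * s * s + poly_to_L e * s * poly_to_L t
      = poly_to_L a * s * poly_to_L u + poly_to_L b * poly_to_L u * poly_to_L t"
    using clear_denominators[OF rel t0] .
  then have zero: "poly_to_L (c * D - b * t * u) + poly_to_L (e * t - a * u) * s = 0"
    unfolding poly_to_L_diff poly_to_L_mult s[symmetric] by algebra
  have "c * D = b * t * u" "e * t = a * u"
    using sqrt_linear_independent[OF ns s zero] by auto
  then have "poly (c * D) l = poly (b * t * u) l" "poly (e * t) l = poly (a * u) l" by simp_all
  then have "poly c l = 0" "poly a l = 0" using assms(3,4) by (simp_all add: t_def u_def)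
  moreover obtain k where "1 = (a * e - b * c) * k" using unit by (auto simp: dvd_def)
  then have "poly 1 l = poly ((a * e - b * c) * k) l" by (rule arg_cong)
  ultimately show False by simp
qed

text \<open>Pigeonhole: over a field of order k there are k^(n+1) polynomials \<open>y\<close> of
  degree at most \<open>n\<close>, but only k^n choices for the coefficients of \<open>y * s\<close>
  at the powers -1 to -n of T. Two \<open>y\<close> agreeing there are subtracted, and
  \<open>x\<close> is the polynomial part of \<open>y * s\<close>.\<close>

lemma dirichlet_approximation:
  fixes s :: "'a::field fls"
  assumes fin: "finite (UNIV :: 'a set)"
  obtains x y where "y \<noteq> 0" and "degree y \<le> n"
    and "\<And>k. k \<le> int n \<Longrightarrow> fls_nth (poly_to_L x - poly_to_L y * s) k = 0"
proof -
  define A where "A = (PiE {..n} (\<lambda>_. UNIV :: 'a set))"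
  define B where "B = (PiE {1..n} (\<lambda>_. UNIV :: 'a set))"
  define Y where "Y c = (\<Sum>i\<le>n. monom (c i) i)" for c :: "nat \<Rightarrow> 'a"
  define h where "h c = (\<lambda>i\<in>{1..n}. fls_nth (poly_to_L (Y c) * s) (int i))" for c
  have "card {0, 1 :: 'a} \<le> card (UNIV :: 'a set)" by (rule card_mono[OF fin]) simp
  then have "card B < card A"
    unfolding A_def B_def by (simp add: card_PiE)
  moreover have "finite A" "finite B" unfolding A_def B_def using fin by (auto intro: finite_PiE)
  moreover have "h ` A \<subseteq> B" unfolding h_def B_def by auto
  ultimately have "\<not> inj_on h A" by (meson card_inj_on_le not_le)
  then obtain c c' where c: "c \<in> A" "c' \<in> A" "h c = h c'" "c \<noteq> c'" by (auto simp: inj_on_def)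
  define y where "y = Y c - Y c'"
  have coeff_Y: "coeff (Y c) i = (if i \<le> n then c i else 0)" for c i
    unfolding Y_def coeff_sum by simp
  show ?thesis
  proof
    obtain i where "c i \<noteq> c' i" using c(4) by auto
    moreover have "i \<le> n" using calculation c(1,2) unfolding A_def PiE_def extensional_def by force
    ultimately have "coeff y i \<noteq> 0" unfolding y_def by (simp add: coeff_Y)
    then show "y \<noteq> 0" by auto
    show "degree y \<le> n" unfolding y_def by (intro degree_le) (simp add: coeff_Y)
    fix k :: int assume k: "k \<le> int n"
    show "fls_nth (poly_to_L (poly_part (poly_to_L y * s)) - poly_to_L y * s) k = 0"
    proof (cases "k \<le> 0")
      case True
      then show ?thesis by (simp add: poly_to_L_nth poly_part_nth)
    next
      case False
      then have k1: "nat k \<in> {1..n}" using k by auto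
      have "fls_nth (poly_to_L (Y c) * s) k = fls_nth (poly_to_L (Y c') * s) k"
        using fun_cong[OF c(3), of "nat k"] k1 False by (simp add: h_def)
      then show ?thesis using False by (simp add: poly_to_L_nth y_def left_diff_distrib)
    qed
  qed
qed

lemma finite_bounded_degree_polys:
  assumes "finite (UNIV :: 'a::zero set)"
  shows "finite {p :: 'a poly. degree p \<le> n}"
proof (rule finite_subset)
  show "{p :: 'a poly. degree p \<le> n} \<subseteq> Poly ` {xs. set xs \<subseteq> UNIV \<and> length xs \<le> Suc n}"
  proof
    fix p :: "'a poly" assume "p \<in> {p. degree p \<le> n}"
    then have "length (coeffs p) \<le> Suc n" by (simp add: coeffs_def)
    then show "p \<in> Poly ` {xs. set xs \<subseteq> UNIV \<and> length xs \<le> Suc n}"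
      by (intro image_eqI[of _ _ "coeffs p"]) simp_all
  qed
  show "finite (Poly ` {xs :: 'a list. set xs \<subseteq> UNIV \<and> length xs \<le> Suc n})"
    using assms by (intro finite_imageI finite_lists_length_le)
qed

text \<open>With \<open>r = x - y * s\<close> the norm is \<open>r * r + 2 * r * (y * s)\<close>,
  where \<open>r\<close> has degree below \<open>-n\<close> and \<open>y * s\<close> has degree at
  most \<open>n + d\<close>.\<close>

lemma degree_norm_le:
  assumes s: "s\<^sup>2 = poly_to_L D" and deg: "degree D = 2 * d"
    and "degree y \<le> n"
    and small: "\<And>k. k \<le> int n \<Longrightarrow> fls_nth (poly_to_L x - poly_to_L y * s) k = 0"
  shows "degree (x\<^sup>2 - D * y\<^sup>2) \<le> d"
proof (rule degree_le, intro allI impI)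
  fix i assume i: "d < i"
  define r where "r = poly_to_L x - poly_to_L y * s"
  show "coeff (x\<^sup>2 - D * y\<^sup>2) i = 0"
  proof (cases "r = 0")
    case True
    then have "poly_to_L (x\<^sup>2 - D * y\<^sup>2) = 0"
      unfolding r_def poly_to_L_diff poly_to_L_mult poly_to_L_power s[symmetric] by algebra
    then have "x\<^sup>2 - D * y\<^sup>2 = 0" by (simp only: poly_to_L_eq_0_iff)
    then show ?thesis by simp
  next
    case False
    then have r: "int n < fls_subdegree r"
      using small unfolding r_def by (intro fls_subdegree_greaterI) auto
    have ys: "poly_to_L y * s = 0 \<or> fls_subdegree (poly_to_L y * s) \<ge> - int n - int d"
      using assms(3) by (cases "poly_to_L y * s = 0")
        (auto simp: fls_subdegree_poly_to_L fls_subdegree_sqrt[OF s deg])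
    have "fls_nth (r * r) (- int i) = 0" using r by (intro fls_times_nth_eq0) simp
    moreover have "fls_nth (r * (poly_to_L y * s)) (- int i) = 0"
      using ys
    proof
      assume "- int n - int d \<le> fls_subdegree (poly_to_L y * s)"
      then show ?thesis using r i by (intro fls_times_nth_eq0) linarith
    qed (simp only: mult_zero_right fls_zero_nth)
    moreover have "poly_to_L (x\<^sup>2 - D * y\<^sup>2) = r * r + (r * (poly_to_L y * s) + r * (poly_to_L y * s))"
      unfolding r_def poly_to_L_diff poly_to_L_mult poly_to_L_power s[symmetric] by algebra
    ultimately have "fls_nth (poly_to_L (x\<^sup>2 - D * y\<^sup>2)) (- int i) = 0"
      by (simp only: fls_plus_nth add_0)
    then show ?thesis unfolding poly_to_L_nth by simp
  qed
qed

text \<open>Good approximations have norms of bounded degree. Over a finite field two of them share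
  the norm and the residues modulo it, and their quotient is then integral of norm 1.\<close>

lemma finite_field_pell_solution:
  fixes D :: "'a::field poly"
  assumes fin: "finite (UNIV :: 'a set)" and ns: "nonsquare D" and deg: "degree D = 2 * d"
    and s: "s\<^sup>2 = poly_to_L D"
  obtains p q where "q \<noteq> 0" and "degree (p\<^sup>2 - D * q\<^sup>2) = 0"
proof -
  have "\<exists>x y. y \<noteq> 0 \<and> degree y \<le> n \<and>
      (\<forall>k \<le> int n. fls_nth (poly_to_L x - poly_to_L y * s) k = 0)" for n
    using dirichlet_approximation[OF fin, of n s] by metis
  then obtain X Y where Y0: "\<And>n. Y n \<noteq> 0" and dY: "\<And>n. degree (Y n) \<le> n"
    and small: "\<And>n k. k \<le> int n \<Longrightarrow> fls_nth (poly_to_L (X n) - poly_to_L (Y n) * s) k = 0"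
    by metis
  define r where "r n = poly_to_L (X n) - poly_to_L (Y n) * s" for n
  have r0: "r n \<noteq> 0" for n
  proof
    assume "r n = 0"
    then have "poly_to_L (X n) + poly_to_L (- Y n) * s = 0" by (simp add: r_def)
    then show False using sqrt_linear_independent(2)[OF ns s] Y0 by (metis neg_equal_0_iff_equal)
  qed
  have r_small: "int n < fls_subdegree (r n)" for n
    using small r0 unfolding r_def by (intro fls_subdegree_greaterI) auto
  define N where "N n = (X n)\<^sup>2 - D * (Y n)\<^sup>2" for n
  have dN: "degree (N n) \<le> d" for n
    unfolding N_def using degree_norm_le[OF s deg dY] small by blast
  have N0: "N n \<noteq> 0" for n
    using nonsquare_irrational[OF ns] Y0 by (auto simp: N_def)
  have dmod: "degree (z mod N n) \<le> d" for z n
    using degree_mod_less[OF N0, of z n] dN[of n] by auto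
  let ?code = "\<lambda>n. (N n, X n mod N n, Y n mod N n)"
  let ?P = "{p :: 'a poly. degree p \<le> d}"
  have "range ?code \<subseteq> ?P \<times> ?P \<times> ?P" using dN dmod by auto
  then have "finite (range ?code)"
    using finite_bounded_degree_polys[OF fin, of d] by (meson finite_SigmaI finite_subset)
  then obtain i where inf: "infinite {n \<in> UNIV. ?code n = ?code i}"
    using pigeonhole_infinite[of UNIV ?code] by auto
  \<comment> \<open>The lower bound on \<open>j\<close> makes the second approximation too good to
    be proportional to the first; this yields \<open>q \<noteq> 0\<close> below.\<close>
  obtain j where j: "?code j = ?code i" "j \<ge> nat (int (degree (Y i)) + fls_subdegree (r i))"
    using inf unfolding infinite_nat_iff_unbounded_le by auto
  have Nj: "N j = N i" using j(1) by simp
  have "N i dvd X j - X i" "N i dvd Y j - Y i"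
    using j(1) Nj by (metis mod_eq_dvd_iff prod.inject)+
  then obtain x y where xy: "X j - X i = N i * x" "Y j - Y i = N i * y" by (auto simp: dvd_def)
  \<comment> \<open>\<open>p + q * s\<close> is the quotient of \<open>X j + Y j * s\<close> by
    \<open>X i + Y i * s\<close>, written out with the congruences so that it is visibly
    polynomial.\<close>
  define p q where "p = X i * x - D * Y i * y + 1" and "q = X i * y - x * Y i"
  have Np: "N i * p = X i * X j - D * Y i * Y j"
  proof -
    have "N i * p = X i * (N i * x) - D * Y i * (N i * y) + N i" unfolding p_def by algebra
    also have "\<dots> = X i * X j - D * Y i * Y j" unfolding xy[symmetric] unfolding N_def by algebra
    finally show ?thesis .
  qed
  have Nq: "N i * q = X i * Y j - X j * Y i"
  proof -
    have "N i * q = X i * (N i * y) - (N i * x) * Y i" unfolding q_def by algebra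
    also have "\<dots> = X i * Y j - X j * Y i" unfolding xy[symmetric] by algebra
    finally show ?thesis .
  qed
  have "(N i)\<^sup>2 * (p\<^sup>2 - D * q\<^sup>2) = (N i * p)\<^sup>2 - D * (N i * q)\<^sup>2" by algebra
  also have "\<dots> = N i * N j" unfolding Np Nq unfolding N_def by algebra
  also have "\<dots> = (N i)\<^sup>2 * 1" unfolding Nj by (simp add: power2_eq_square)
  finally have "p\<^sup>2 - D * q\<^sup>2 = 1" using N0[of i] by simp
  moreover have "q \<noteq> 0"
  proof
    assume "q = 0"
    then have "X i * Y j = X j * Y i" using Nq by simp
    then have "poly_to_L (X i) * poly_to_L (Y j) = poly_to_L (X j) * poly_to_L (Y i)"
      by (metis poly_to_L_mult)
    then have "poly_to_L (Y i) * r j = poly_to_L (Y j) * r i" unfolding r_def by algebra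
    then have "fls_subdegree (poly_to_L (Y i) * r j) = fls_subdegree (poly_to_L (Y j) * r i)" by simp
    then have "fls_subdegree (r j) - int (degree (Y i)) = fls_subdegree (r i) - int (degree (Y j))"
      using Y0 r0 by (simp add: fls_subdegree_poly_to_L)
    then show False using r_small[of j] j(2) by linarith
  qed
  ultimately show ?thesis using that[of q p] by simp
qed

section \<open>Discriminants with nontrivial Pell equation\<close>

context pell_solution
begin

text \<open>Since \<open>degree p = degree q + d\<close>, the difference of the conjugates has
  degree 0. The values are \<open>N / p^2\<close>, so the bound wanted is
  \<open>degree_form_ge\<close>.\<close>

lemma well_spaced_pell:
  assumes s: "s\<^sup>2 = poly_to_L D"
  defines "\<alpha> \<equiv> poly_to_L q * (1 + s) / poly_to_L p"
    and "\<alpha>' \<equiv> poly_to_L q * (1 - s) / poly_to_L p"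
  shows "well_spaced d \<alpha> \<alpha>'" and "fls_subdegree (\<alpha> - \<alpha>') \<le> 0"
proof -
  have s0: "s \<noteq> 0" using s D_nz by auto
  have diff: "\<alpha> - \<alpha>' = 2 * s * poly_to_L q / poly_to_L p"
    unfolding \<alpha>_def \<alpha>'_def using p_nz by (simp add: field_simps)
  have nz: "2 * s * poly_to_L q \<noteq> 0" using numeral_2_fls_nonzero[OF two] s0 q_nz by simp
  have sdiff: "fls_subdegree (\<alpha> - \<alpha>') = 0"
    unfolding diff using nz p_nz
    by (simp add: fls_subdegree_divide fls_subdegree_poly_to_L fls_subdegree_sqrt[OF s deg_D] degree_p)
  then show "fls_subdegree (\<alpha> - \<alpha>') \<le> 0" by simp
  show "well_spaced d \<alpha> \<alpha>'"
    unfolding well_spaced_def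
  proof (intro conjI allI impI)
    show "\<alpha> \<noteq> \<alpha>'" using diff nz p_nz by auto
    fix x y :: "'a poly" assume xy: "x \<noteq> 0 \<or> y \<noteq> 0"
    \<comment> \<open>As \<open>p * x - q * y = u + p * y\<close>, the Pell equation turns the norm
      into the form of \<open>degree_form_ge\<close>, and \<open>u + q * y\<close> is a multiple of
      \<open>p\<close>.\<close>
    define u where "u = p * (x - y) - q * y"
    define N where "N = u\<^sup>2 + 2 * p * u * y + [:nu:] * y\<^sup>2"
    have N: "N = (p * x - q * y)\<^sup>2 - D * (q * y)\<^sup>2"
      unfolding N_def u_def using pell by algebra
    let ?v = "(poly_to_L x - \<alpha> * poly_to_L y) * (poly_to_L x - \<alpha>' * poly_to_L y)"
    have eq: "?v = poly_to_L N / poly_to_L (p\<^sup>2)"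
      unfolding N \<alpha>_def \<alpha>'_def using p_nz
      by (simp add: field_simps power2_eq_square s[symmetric])
    have "p dvd u + q * y" unfolding u_def by simp
    moreover have "u \<noteq> 0 \<or> y \<noteq> 0" unfolding u_def using xy p_nz by auto
    ultimately have dN: "2 * degree p \<le> degree N + d"
      unfolding N_def using degree_form_ge by blast
    then have "degree N > 0" using degree_p d_pos by linarith
    then have N0: "N \<noteq> 0" by auto
    have "fls_subdegree ?v = 2 * int (degree p) - int (degree N)"
      unfolding eq using N0 p_nz
      by (subst fls_subdegree_divide) (simp_all add: fls_subdegree_poly_to_L degree_power_eq del: poly_to_L_power)
    moreover have "?v \<noteq> 0" unfolding eq using N0 p_nz by simp
    ultimately show "let v = ?v in v \<noteq> 0 \<and> fls_subdegree v \<le> fls_subdegree (\<alpha> - \<alpha>') + int d"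
      unfolding Let_def sdiff using dN by linarith
  qed
qed

text \<open>Comparing coefficients of 1 and \<open>s\<close> shows that \<open>q\<close> divides
  \<open>a * q'\<close> and \<open>b * p'\<close>, hence \<open>q' * p'\<close> times the
  determinant, which is a unit.\<close>

lemma pell_moebius_related_dvd:
  assumes s: "s\<^sup>2 = poly_to_L D" and "p' \<noteq> 0"
    and rel: "moebius_related (poly_to_L q' * (1 + s) / poly_to_L p') (poly_to_L q * (1 + s) / poly_to_L p)"
  shows "q dvd q' * p'"
proof -
  obtain a b c e where unit: "(a * e - b * c) dvd 1"
    and rel: "poly_to_L c * (poly_to_L q' * (1 + s) / poly_to_L p') * (poly_to_L q * (1 + s) / poly_to_L p)
        + poly_to_L e * (poly_to_L q * (1 + s) / poly_to_L p)
      = poly_to_L a * (poly_to_L q' * (1 + s) / poly_to_L p') + poly_to_L b"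
    using rel unfolding moebius_related_def by blast
  have clear: "poly_to_L c * (poly_to_L q' * (1 + s)) * (poly_to_L q * (1 + s))
        + poly_to_L e * (poly_to_L q * (1 + s)) * poly_to_L p'
      = poly_to_L a * (poly_to_L q' * (1 + s)) * poly_to_L p + poly_to_L b * poly_to_L p * poly_to_L p'"
    using clear_denominators[OF rel] assms(2) p_nz by simp
  have zero: "poly_to_L (c * q' * q * (1 + D) + e * q * p' - a * q' * p - b * p * p')
      + poly_to_L (2 * c * q' * q + e * q * p' - a * q' * p) * s = 0"
    using clear s unfolding poly_to_L_diff poly_to_L_mult poly_to_L_add poly_to_L_1 poly_to_L_numeral
    by algebra
  have E: "c * q' * q * (1 + D) + e * q * p' - a * q' * p - b * p * p' = 0"
    "2 * c * q' * q + e * q * p' - a * q' * p = 0"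
    using sqrt_linear_independent[OF nonsq s zero] by auto
  have "a * q' * p = q * (2 * c * q' + e * p')" using E(2) by algebra
  then have a: "q dvd a * q'" by (metis q_dvd_mult_p dvd_triv_left)
  \<comment> \<open>In the difference of the two equations \<open>a\<close> and \<open>e\<close>
    cancel.\<close>
  have "b * p' * p = q * (c * q' * (D - 1))" using E by algebra
  then have b: "q dvd b * p'" by (metis q_dvd_mult_p dvd_triv_left)
  have "q dvd (a * q') * (p' * e) - (b * p') * (q' * c)"
    by (intro dvd_diff dvd_mult2[OF a] dvd_mult2[OF b])
  also have "(a * q') * (p' * e) - (b * p') * (q' * c) = (q' * p') * (a * e - b * c)" by algebra
  also have "\<dots> dvd q' * p'" using mult_dvd_mono[OF dvd_refl unit, of "q' * p'"] by simp
  finally show ?thesis .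
qed

text \<open>The cube of \<open>p + q * sqrt D\<close>.\<close>

lemma pell_cube:
  defines "p' \<equiv> p * ((2 * p)\<^sup>2 - 3 * [:nu:])" and "q' \<equiv> q * ((2 * p)\<^sup>2 - [:nu:])"
  shows "pell_solution D p' q' (nu ^ 3) d" and "degree q' > degree (q * p)"
proof -
  have "degree (2 * p) = degree p"
    using two_poly p_nz by (subst degree_mult_eq) (simp_all add: numeral_poly)
  moreover have "2 * p \<noteq> 0" using two_poly p_nz by simp
  ultimately have d4: "degree ((2 * p)\<^sup>2) = 2 * degree p"
    using degree_power_eq[of "2 * p" 2] by argo
  have p1: "degree p > 0" using degree_p d_pos by simp
  have "degree ((2 * p)\<^sup>2 - [:nu:]) = 2 * degree p"
    unfolding diff_conv_add_uminus
    by (rule trans[OF degree_add_eq_left d4]) (use d4 p1 in simp)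
  moreover have "(2 * p)\<^sup>2 - [:nu:] \<noteq> 0" using calculation p1 by auto
  ultimately have dq: "q' \<noteq> 0" "degree q' = degree q + 2 * degree p"
    unfolding q'_def using q_nz by (auto simp: degree_mult_eq)
  \<comment> \<open>Strictness is what cubing buys: the square of \<open>p + q * s\<close> has
    second component \<open>2 * p * q\<close>, of the same degree as \<open>q * p\<close>.\<close>
  show "degree q' > degree (q * p)" using dq p1 q_nz p_nz by (simp add: degree_mult_eq)
  have "p'\<^sup>2 = D * q'\<^sup>2 + [:nu:] ^ 3"
    unfolding p'_def q'_def using pell by algebra
  then have "p'\<^sup>2 = D * q'\<^sup>2 + [:nu ^ 3:]" by (simp add: poly_const_pow)
  then show "pell_solution D p' q' (nu ^ 3) d"
    using nonsq deg_D d_pos nu two dq(1) by unfold_locales auto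
qed

text \<open>Iterated cubing. The degree gap is stated so that it contradicts the divisibility in
  \<open>pell_moebius_related_dvd\<close>; it passes from consecutive to arbitrary indices because
  the degrees of \<open>Q\<close> increase.\<close>

lemma infinite_pell_family:
  "\<exists>P Q V. (\<forall>n::nat. pell_solution D (P n) (Q n) (V n) d) \<and>
    (\<forall>m n. m < n \<longrightarrow> degree (Q m * P m) < degree (Q n))"
proof -
  let ?sol = "\<lambda>(p', q', nu'). pell_solution D p' q' nu' d"
  have "\<exists>f. \<forall>n. ?sol (f n) \<and>
    degree (fst (snd (f n)) * fst (f n)) < degree (fst (snd (f (Suc n))))"
  proof (rule dependent_nat_choice)
    have "?sol (p, q, nu)" using pell_solution_axioms by simp
    then show "\<exists>x. ?sol x" by blast
    fix x :: "'a poly \<times> 'a poly \<times> 'a" and n :: nat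
    assume "?sol x"
    then obtain p' q' nu' where x: "x = (p', q', nu')" and sol: "pell_solution D p' q' nu' d"
      by (cases x) auto
    show "\<exists>y. ?sol y \<and> degree (fst (snd x) * fst x) < degree (fst (snd y))"
      using pell_solution.pell_cube[OF sol]
      by (intro exI[of _ "(p' * ((2 * p')\<^sup>2 - 3 * [:nu':]), q' * ((2 * p')\<^sup>2 - [:nu':]), nu' ^ 3)"])
        (simp add: x)
  qed
  then obtain f where f: "\<forall>n. ?sol (f n) \<and>
    degree (fst (snd (f n)) * fst (f n)) < degree (fst (snd (f (Suc n))))"
    by (elim exE)
  define P Q V where "P n = fst (f n)" and "Q n = fst (snd (f n))" and "V n = snd (snd (f n))" for n
  have sol: "pell_solution D (P n) (Q n) (V n) d" for n
    using f[THEN spec, of n] unfolding P_def Q_def V_def by (simp add: case_prod_beta)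
  have step: "degree (Q n * P n) < degree (Q (Suc n))" for n
    using f by (simp add: P_def Q_def)
  have "degree (Q n) \<le> degree (Q n * P n)" for n
    using pell_solution.q_nz[OF sol] pell_solution.p_nz[OF sol] by (simp add: degree_mult_eq)
  then have "degree (Q n) \<le> degree (Q (Suc n))" for n
    using step[of n] by (meson le_less_trans less_imp_le)
  then have mono: "m \<le> n \<Longrightarrow> degree (Q m) \<le> degree (Q n)" for m n
    by (rule lift_Suc_mono_le)
  have "degree (Q m * P m) < degree (Q n)" if "m < n" for m n
    using step[of m] mono[of "Suc m" n] that by simp
  then show ?thesis using sol by blast
qed

end

section \<open>The trivial and the nontrivial Pell equation combined\<close>

lemma CHAR_not_2_imp_two_nonzero:
  assumes "CHAR('a::field) \<noteq> 2"
  shows "(2::'a) \<noteq> 0"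
proof
  assume "(2::'a) = 0"
  then have "of_nat 2 = (0::'a)" by simp
  then have "CHAR('a) dvd 2" by (simp only: of_nat_eq_0_iff_char_dvd)
  then have "CHAR('a) = 1 \<or> CHAR('a) = 2"
    using two_is_prime_nat unfolding prime_nat_iff by blast
  then show False using assms CHAR_not_1 by auto
qed

theorem mainTheorem9:
  fixes D :: "'a::field poly" and d :: nat and sqrtD :: "'a fls"
  assumes "CHAR('a) \<noteq> 2"
    and "in_S D" and "degree D = 2 * d"
    and "sqrtD ^ 2 = poly_to_L D"
  shows "\<exists>A \<subseteq> adjoin_T sqrtD. infinite A \<and> (\<forall>\<alpha>\<in>A. K_sup \<alpha> \<le> enat d)
           \<and> (\<forall>\<alpha>\<in>A. \<forall>\<beta>\<in>A. \<alpha> \<noteq> \<beta> \<longrightarrow> \<not> cf_equivalent \<alpha> \<beta>)"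
proof -
  have two: "(2::'a) \<noteq> 0" by (rule CHAR_not_2_imp_two_nonzero[OF assms(1)])
  have ns: "nonsquare D" and d: "d > 0" using assms(2,3) by (auto simp: in_S_def nonsquare_def)
  note s = assms(4)
  note F = is_subfield_adjoin_T[of sqrtD]
  show ?thesis
  proof (cases "\<exists>p q. q \<noteq> 0 \<and> degree (p\<^sup>2 - D * q\<^sup>2) = 0")
    case True
    then obtain p q where q: "q \<noteq> 0" and "degree (p\<^sup>2 - D * q\<^sup>2) = 0" by blast
    then obtain nu where nu: "p\<^sup>2 - D * q\<^sup>2 = [:nu:]" by (auto elim: degree_eq_zeroE)
    \<comment> \<open>The zero polynomial also has degree 0, so irrationality must exclude a
      vanishing norm.\<close>
    have "nu \<noteq> 0" using nu nonsquare_irrational[OF ns, of p q] q by auto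
    then interpret pell_solution D p q nu d
      using ns assms(3) d nu q two by unfold_locales (auto simp: algebra_simps)
    obtain P Q V where family: "(\<forall>n::nat. pell_solution D (P n) (Q n) (V n) d) \<and>
        (\<forall>m n. m < n \<longrightarrow> degree (Q m * P m) < degree (Q n))"
      using infinite_pell_family by (elim exE)
    then have sol: "pell_solution D (P n) (Q n) (V n) d"
      and incr: "m < n \<Longrightarrow> degree (Q m * P m) < degree (Q n)" for m n by blast+
    define f where "f n = poly_to_L (Q n) * (1 + sqrtD) / poly_to_L (P n)" for n :: nat
    have not_related: "\<not> moebius_related (f m) (f n)" if "m < n" for m n
    proof
      assume "moebius_related (f m) (f n)"
      then have "Q n dvd Q m * P m"
        unfolding f_def
        by (rule pell_solution.pell_moebius_related_dvd[OF sol s pell_solution.p_nz[OF sol]])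
      moreover have "Q m * P m \<noteq> 0"
        using pell_solution.p_nz[OF sol] pell_solution.q_nz[OF sol] by simp
      ultimately show False using dvd_imp_degree_le incr[OF that] by (meson not_le)
    qed
    show ?thesis
    proof (rule infinite_inequivalent_family[of "UNIV :: nat set" f])
      fix n :: nat
      have "1 \<in> adjoin_T sqrtD" using F by (simp add: is_subfield_def)
      then have "1 + sqrtD \<in> adjoin_T sqrtD" using subfield_add[OF F] self_in_adjoin_T by blast
      then have "f n \<in> adjoin_T sqrtD"
        unfolding f_def using F poly_to_L_in_adjoin_T subfield_divide[OF F]
        unfolding is_subfield_def by blast
      moreover have "K_sup (f n) \<le> enat d"
        unfolding f_def using pell_solution.well_spaced_pell[OF sol s]
        by (rule K_sup_le_if_well_spaced)
      ultimately show "f n \<in> adjoin_T sqrtD \<and> K_sup (f n) \<le> enat d" by blast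
    next
      fix m n :: nat assume "m \<noteq> n"
      then show "\<not> moebius_related (f m) (f n)"
        using not_related moebius_related_sym by (meson linorder_neqE_nat)
    qed simp
  next
    case False
    then have nonpell: "degree (p\<^sup>2 - D * q\<^sup>2) \<noteq> 0" if "q \<noteq> 0" for p q
      using that by metis
    have inf: "infinite (UNIV :: 'a set)"
      using finite_field_pell_solution[OF _ ns assms(3) s] nonpell by metis
    \<comment> \<open>Inequivalence is shown at points \<open>l\<close> that are not roots of
      \<open>D\<close>; this removes only finitely many elements of the infinite field.\<close>
    define I where "I = {l. poly D l \<noteq> 0}"
    have "D \<noteq> 0" using d assms(3) by auto
    then have "finite (- I)" unfolding I_def using poly_roots_finite[of D] by (simp add: Compl_eq)
    then have "infinite I" using inf by (metis Compl_partition finite_UnI)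
    show ?thesis
    proof (rule infinite_inequivalent_family[OF \<open>infinite I\<close>])
      fix l assume "l \<in> I"
      have "degree [:- l, 1:] = 1" by simp
      note ws = well_spaced_sqrt_over_linear[OF two d assms(3) s nonpell this]
      have "K_sup (sqrtD / poly_to_L [:- l, 1:]) \<le> enat d"
        by (rule K_sup_le_if_well_spaced[OF ws])
      then show "sqrtD / poly_to_L [:- l, 1:] \<in> adjoin_T sqrtD \<and>
          K_sup (sqrtD / poly_to_L [:- l, 1:]) \<le> enat d"
        using subfield_divide[OF F self_in_adjoin_T poly_to_L_in_adjoin_T] by blast
    next
      fix l m assume "l \<in> I" "m \<in> I" "l \<noteq> m"
      then show "\<not> moebius_related (sqrtD / poly_to_L [:- l, 1:]) (sqrtD / poly_to_L [:- m, 1:])"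
        using sqrt_over_linear_not_moebius_related[OF ns s] unfolding I_def by blast
    qed
  qed
qed

end
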